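(* Let $(X,d)$ be an ultrametric space with at least two points. Then for every integer $k>2$ there is no finite $k$-metric basis of $(X,d)$.
   Context: A metric space $(X,d)$ is ultrametric if $d(x,y)\le\max\{d(x,z),d(z,y)\}$ for all $x,y,z\in X$. Points $x,y\in X$ are distinguished by $z\in X$ if $d(x,z)\neq d(y,z)$. For a positive integer $k$, a set $S\subseteq X$ is a $k$-metric generator for $X$ if any pair of different points of $X$ is distinguished by at least $k$ elements of $S$. A $k$-metric basis is a $k$-metric generator of minimum cardinality in $X$ (if no $k$-metric generator exists, there is no $k$-metric basis). *)

theory Defs
  imports "HOL-Analysis.Abstract_Metric_Spaces" "HOL-Library.Equipollence"
begin

locale Ultrametric_space = Metric_space +
  assumes ultrametric:
    "\<lbrakk>x \<in> M; y \<in> M; z \<in> M\<rbrakk> \<Longrightarrow> d x y \<le> max (d x z) (d z y)"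

context Metric_space
begin

definition distinguishes :: "'a \<Rightarrow> 'a \<Rightarrow> 'a \<Rightarrow> bool" where
  "distinguishes z x y \<longleftrightarrow> d x z \<noteq> d y z"

(* card is 0 on infinite sets, so infinitely many distinguishing points
   have to be counted as "at least k" separately. *)
definition k_metric_generator :: "nat \<Rightarrow> 'a set \<Rightarrow> bool" where
  "k_metric_generator k S \<longleftrightarrow>
     S \<subseteq> M \<and>
     (\<forall>x\<in>M. \<forall>y\<in>M. x \<noteq> y \<longrightarrow>
        (let D = {z \<in> S. distinguishes z x y} in infinite D \<or> k \<le> card D))"

(* Generators may be infinite, so cardinalities are compared by injections. *)
definition k_metric_basis :: "nat \<Rightarrow> 'a set \<Rightarrow> bool" where
  "k_metric_basis k S \<longleftrightarrow>
     k_metric_generator k S \<and> (\<forall>T. k_metric_generator k T \<longrightarrow> S \<lesssim> T)"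

end

end

theory Submission imports Defs begin

text \<open>
  Suppose a finite set is a \<open>k\<close>-metric generator with \<open>k > 2\<close>.  Any pair of points of the space
  is distinguished by at least \<open>k\<close> of its elements, so it has two elements, and among these
  pairs one at minimal distance.  A third element is at least as far from either point of that
  pair as they are from each other, so by the ultrametric inequality it is equally far from
  both (\<open>not_distinguishes_far\<close>).  Only the two points themselves are left to distinguish the
  pair, and two is less than \<open>k\<close>.  So every such generator is infinite.
\<close>

lemma finite_closest_pair:
  fixes d :: "'a \<Rightarrow> 'a \<Rightarrow> 'b::linorder"
  assumes "finite S" "a \<in> S" "b \<in> S" "a \<noteq> b"
  obtains x y where "x \<in> S" "y \<in> S" "x \<noteq> y"
    and "\<And>u v. \<lbrakk>u \<in> S; v \<in> S; u \<noteq> v\<rbrakk> \<Longrightarrow> d x y \<le> d u v"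
proof -
  define P where "P = {(u, v) \<in> S \<times> S. u \<noteq> v}"
  have "P \<subseteq> S \<times> S" "(a, b) \<in> P"
    using assms by (auto simp: P_def)
  then have "finite P" "P \<noteq> {}"
    using finite_subset[of P "S \<times> S"] assms(1) by auto
  then obtain p where "is_arg_min (case_prod d) (\<lambda>q. q \<in> P) p"
    using ex_is_arg_min_if_finite by blast
  moreover obtain x y where "p = (x, y)"
    by fastforce
  ultimately have "(x, y) \<in> P" "\<And>u v. (u, v) \<in> P \<Longrightarrow> d x y \<le> d u v"
    by (auto simp: is_arg_min_linorder)
  then show thesis
    using that[of x y] by (simp add: P_def)
qed

context Ultrametric_space
begin

text \<open>
  The ultrametric inequality bounds each of \<open>d x z\<close> and \<open>d y z\<close> by the maximum of the other
  and \<open>d x y\<close>; here \<open>d x y\<close> never exceeds the other, so each is bounded by the other.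
\<close>

lemma not_distinguishes_far:
  assumes "x \<in> M" "y \<in> M" "z \<in> M" "d x y \<le> d x z" "d x y \<le> d y z"
  shows "\<not> distinguishes z x y"
  using ultrametric[of x z y] ultrametric[of y z x] assms commute[of y x]
  by (auto simp: distinguishes_def max_def split: if_splits)

lemma k_metric_generator_infinite:
  assumes gen: "k_metric_generator k S" and "k > 2"
    and ab: "a \<in> M" "b \<in> M" "a \<noteq> b"
  shows "infinite S"
proof
  assume fin: "finite S"
  have large: "k \<le> card {z \<in> S. distinguishes z x y}" if "x \<in> M" "y \<in> M" "x \<noteq> y" for x y
    using gen that fin by (auto simp: k_metric_generator_def Let_def)
  have SM: "S \<subseteq> M"
    using gen by (simp add: k_metric_generator_def)
  have "k \<le> card S"
    using large[OF ab] card_mono[OF fin, of "{z \<in> S. distinguishes z a b}"] by auto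
  then obtain u v where "u \<in> S" "v \<in> S" "u \<noteq> v"
    using \<open>k > 2\<close> card_le_Suc0_iff_eq[OF fin] by force
  then obtain x y where xy: "x \<in> S" "y \<in> S" "x \<noteq> y"
    and closest: "\<And>u v. \<lbrakk>u \<in> S; v \<in> S; u \<noteq> v\<rbrakk> \<Longrightarrow> d x y \<le> d u v"
    using finite_closest_pair[OF fin, of u v d] by metis
  have "{z \<in> S. distinguishes z x y} \<subseteq> {x, y}"
  proof (intro subsetI, rule ccontr)
    fix z assume z: "z \<in> {z \<in> S. distinguishes z x y}" "z \<notin> {x, y}"
    then have "d x y \<le> d x z" "d x y \<le> d y z"
      using closest xy by auto
    then show False
      using not_distinguishes_far[of x y z] z xy SM by auto
  qed
  then have "card {z \<in> S. distinguishes z x y} \<le> card {x, y}"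
    by (simp add: card_mono)
  also have "\<dots> = 2"
    using xy by simp
  finally show False
    using large[of x y] xy SM \<open>k > 2\<close> by fastforce
qed

end

theorem theorem2p29:
  fixes X :: "'a set" and d :: "'a \<Rightarrow> 'a \<Rightarrow> real" and k :: nat
  assumes "Ultrametric_space X d"
    and "\<exists>x\<in>X. \<exists>y\<in>X. x \<noteq> y"
    and "k > 2"
  shows "\<not> (\<exists>S. finite S \<and> Metric_space.k_metric_basis X d k S)"
proof -
  interpret Ultrametric_space X d by fact
  show ?thesis
    using assms(2,3) k_metric_generator_infinite by (auto simp: k_metric_basis_def)
qed

end
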